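(* For independent indeterminates $z$ and $v$, $$\mathcal G(z)\,\mathcal G(v)=\mathcal G(z+v-\delta zv).$$
   Context: Work over $\mathbb Q$. Let $D=\partial_x+\partial_y$, $\mathcal G_0=\mathrm{id}$ and, for $r\geq1$, $\mathcal G_r=y^r\sum_{j=1}^{r}\binom{r-1}{j-1}\frac{x^j}{j!}D^j$, as operators on $\mathbb Q[x,y]$. Put $\mathcal G(z)=\sum_{r\geq0}\mathcal G_r z^r$, a formal power series with operator coefficients; products are formed by composing operators coefficientwise. Here $\delta=y-x$ acts by multiplication, and it commutes with every $\mathcal G_r$ (because $D(y-x)=0$). The right-hand side means $\sum_{r\geq0}\mathcal G_r\,(z+v-\delta zv)^r$, a formal power series in $z,v$ with operator coefficients (well defined since $z+v-\delta zv$ has zero constant term). *)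

theory Defs
  imports "HOL-Computational_Algebra.Computational_Algebra" "HOL-Library.Groups_Big_Fun"
begin

(* Q[x,y] is rat poly poly: the outer variable is y, the coefficients are polynomials in x. *)

definition var_x :: "rat poly poly" where "var_x = [:[:0, 1:]:]"

definition var_y :: "rat poly poly" where "var_y = [:0, 1:]"

definition partial_x :: "rat poly poly \<Rightarrow> rat poly poly" where
  "partial_x = map_poly pderiv"

definition partial_y :: "rat poly poly \<Rightarrow> rat poly poly" where
  "partial_y = pderiv"

lemma coeff_partial_x: "coeff (partial_x p) n = pderiv (coeff p n)"
  by (simp add: partial_x_def coeff_map_poly)

definition rat_linear :: "(rat poly poly \<Rightarrow> rat poly poly) \<Rightarrow> bool" where
  "rat_linear f \<longleftrightarrow> (\<forall>p q. f (p + q) = f p + f q) \<and> (\<forall>c p. f (smult [:c:] p) = smult [:c:] (f p))"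

(* The ring of operators on Q[x,y], made into a type so that power series over it are
   available; multiplication is composition. *)

typedef polyop = "{f. rat_linear f}"
  morphisms op_apply Abs_polyop
  by (rule exI[of _ "\<lambda>p. p"]) (simp add: rat_linear_def)

lemma op_apply_add [simp]: "op_apply f (p + q) = op_apply f p + op_apply f q"
  using op_apply[of f] by (simp add: rat_linear_def)

lemma op_apply_smult [simp]: "op_apply f (smult [:c:] p) = smult [:c:] (op_apply f p)"
  using op_apply[of f] by (simp add: rat_linear_def)

lemma op_apply_Abs: "rat_linear f \<Longrightarrow> op_apply (Abs_polyop f) = f"
  by (simp add: Abs_polyop_inverse)

lemma op_apply_zero [simp]: "op_apply f 0 = 0"
  using op_apply_add[of f 0 0] by simp

lemma polyop_eqI: "(\<And>p. op_apply f p = op_apply g p) \<Longrightarrow> f = g"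
  by (simp add: op_apply_inject[symmetric] fun_eq_iff)

instantiation polyop :: ring_1
begin

definition "0 = Abs_polyop (\<lambda>p. 0)"
definition "1 = Abs_polyop (\<lambda>p. p)"
definition "f + g = Abs_polyop (\<lambda>p. op_apply f p + op_apply g p)"
definition "f - g = Abs_polyop (\<lambda>p. op_apply f p - op_apply g p)"
definition "- f = Abs_polyop (\<lambda>p. - op_apply f p)"
definition "f * g = Abs_polyop (op_apply f \<circ> op_apply g)"

lemma op_apply_0: "op_apply 0 p = 0"
  and op_apply_1: "op_apply 1 p = p"
  and op_apply_plus: "op_apply (f + g) p = op_apply f p + op_apply g p"
  and op_apply_minus: "op_apply (f - g) p = op_apply f p - op_apply g p"
  and op_apply_uminus: "op_apply (- f) p = - op_apply f p"
  and op_apply_times: "op_apply (f * g) p = op_apply f (op_apply g p)"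
  by (simp_all add: zero_polyop_def one_polyop_def plus_polyop_def minus_polyop_def
      uminus_polyop_def times_polyop_def op_apply_Abs rat_linear_def
      smult_add_right smult_diff_right)

instance
proof
  show "(0::polyop) \<noteq> 1"
  proof
    assume "(0::polyop) = 1"
    then have "op_apply 0 1 = op_apply 1 1" by simp
    then show False by (simp add: op_apply_0 op_apply_1)
  qed
qed (auto intro!: polyop_eqI simp: op_apply_0 op_apply_1 op_apply_plus op_apply_minus
    op_apply_uminus op_apply_times)

end

lemmas op_apply_simps [simp] =
  op_apply_0 op_apply_1 op_apply_plus op_apply_minus op_apply_uminus op_apply_times

definition mult_op :: "rat poly poly \<Rightarrow> polyop" where
  "mult_op a = Abs_polyop (\<lambda>p. a * p)"

lemma op_apply_mult_op [simp]: "op_apply (mult_op a) p = a * p"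
  by (simp add: mult_op_def op_apply_Abs rat_linear_def distrib_left)

definition D_op :: polyop where
  "D_op = Abs_polyop (\<lambda>p. partial_x p + partial_y p)"

lemma op_apply_D_op [simp]: "op_apply D_op p = partial_x p + partial_y p"
proof -
  have "rat_linear (\<lambda>p. partial_x p + partial_y p)"
    unfolding rat_linear_def
    by (auto simp: poly_eq_iff coeff_partial_x partial_y_def pderiv_add pderiv_smult
        smult_add_right algebra_simps coeff_pderiv)
  then show ?thesis by (simp add: D_op_def op_apply_Abs)
qed

definition delta_op :: polyop where
  "delta_op = mult_op (var_y - var_x)"

definition G_op :: "nat \<Rightarrow> polyop" where
  "G_op r =
     (if r = 0 then 1
      else mult_op (var_y ^ r) *
        (\<Sum>j=1..r. mult_op (smult [:of_nat ((r - 1) choose (j - 1)) / fact j:] (var_x ^ j)) * D_op ^ j))"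

(* Power series in z and v with operator coefficients are polyop fps fps: the outer variable
   is v, and the coefficient of z^m v^n in w is w $ n $ m.  Both variables are central. *)

definition ser_z :: "polyop fps fps" where "ser_z = fps_const fps_X"

definition ser_v :: "polyop fps fps" where "ser_v = fps_X"

definition ser_op :: "polyop \<Rightarrow> polyop fps fps" where
  "ser_op A = fps_const (fps_const A)"

(* G_at w is the sum over r of G_r w^r, taken coefficientwise.  If w has zero constant term,
   each coefficient is a finite sum by G_at_support.  (fps_compose does not apply: it needs the
   coefficient of v^0 to vanish, which is z for w = z + v - delta z v.) *)

definition G_at :: "polyop fps fps \<Rightarrow> polyop fps fps" where
  "G_at w = Abs_fps (\<lambda>n. Abs_fps (\<lambda>m. Sum_any (\<lambda>r. (ser_op (G_op r) * w ^ r) $ n $ m)))"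

lemma power_low_nth:
  fixes w :: "'a::ring_1 fps fps"
  assumes "w $ 0 $ 0 = 0" and "n + m < r"
  shows "(w ^ r) $ n $ m = 0"
  using assms(2)
proof (induction r arbitrary: n m)
  case 0
  then show ?case by simp
next
  case (Suc r)
  have "w $ i $ j * (w ^ r) $ (n - i) $ (m - j) = 0" if "i \<le> n" "j \<le> m" for i j
  proof (cases "i = 0 \<and> j = 0")
    case True
    then show ?thesis using assms(1) by simp
  next
    case False
    then have "(n - i) + (m - j) < r" using that Suc.prems by linarith
    then show ?thesis using Suc.IH by simp
  qed
  then show ?case by (simp add: fps_mult_nth fps_sum_nth)
qed

lemma G_at_support:
  assumes "w $ 0 $ 0 = 0"
  shows "{r. (ser_op (G_op r) * w ^ r) $ n $ m \<noteq> 0} \<subseteq> {..n + m}"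
  using power_low_nth[OF assms] by (force simp: ser_op_def not_less[symmetric])

lemma G_at_z: "G_at ser_z = fps_const (Abs_fps G_op)"
proof -
  have "(ser_op (G_op r) * ser_z ^ r) $ n $ m = (if n = 0 then (if r = m then G_op r else 0) else 0)"
    for r n m
    by (simp add: ser_op_def ser_z_def fps_X_power_iff)
  moreover have "Sum_any (\<lambda>r. if r = m then G_op r else 0) = G_op m" for m
    by (simp add: Sum_any.delta)
  ultimately show ?thesis
    by (auto simp: fps_eq_iff G_at_def)
qed

lemma G_at_v: "G_at ser_v = Abs_fps (\<lambda>r. fps_const (G_op r))"
proof -
  have "(ser_op (G_op r) * ser_v ^ r) $ n $ m = (if r = n then (if m = 0 then G_op r else 0) else 0)"
    for r n m
    by (simp add: ser_op_def ser_v_def fps_X_power_iff)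
  moreover have "Sum_any (\<lambda>r. if r = n then (if m = 0 then G_op r else 0) else 0)
      = (if m = 0 then G_op n else 0)" for n m :: nat
    by (simp add: Sum_any.delta)
  ultimately show ?thesis
    by (auto simp: fps_eq_iff G_at_def)
qed

end

theory Submission
  imports Defs
begin

text \<open>
  Summing over \<open>r\<close> first gives
  \<open>\<G>(z) = (\<Sum>j. (x y z / (1 - y z))^j D^j / j!)\<close>, which by Taylor's formula is
  the substitution \<open>x \<mapsto> x / (1 - y z)\<close>, \<open>\<delta> \<mapsto> \<delta>\<close>.  Hence both sides, applied to a
  polynomial, are ring homomorphisms from \<open>\<rat>[x,y]\<close> to \<open>\<rat>[x,y][[z,v]]\<close> fixing the
  constants and \<open>\<delta>\<close>, and it suffices to compare them on \<open>x\<close>, which both send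
  to \<open>x / (1 - y (z + v - \<delta> z v))\<close>.
\<close>

section \<open>Linearity of operators and the Leibniz rule for \<open>D_op\<close>\<close>

lemma op_apply_sum: "op_apply f (sum g A) = (\<Sum>i\<in>A. op_apply f (g i))"
  by (induction A rule: infinite_finite_induct) simp_all

lemma sum_op_apply: "op_apply (sum f A) p = (\<Sum>i\<in>A. op_apply (f i) p)"
  by (induction A rule: infinite_finite_induct) simp_all

lemma pderiv_sum: "pderiv (sum f A) = (\<Sum>i\<in>A. pderiv (f i))"
  by (induction A rule: infinite_finite_induct) (simp_all add: pderiv_add)

lemma partial_x_mult: "partial_x (p * q) = partial_x p * q + p * partial_x q"
proof (rule poly_eqI)
  fix n
  have "coeff (partial_x (p * q)) n =
      (\<Sum>i\<le>n. pderiv (coeff p i) * coeff q (n - i) + coeff p i * pderiv (coeff q (n - i)))"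
    by (simp add: coeff_partial_x coeff_mult pderiv_sum pderiv_mult algebra_simps)
  then show "coeff (partial_x (p * q)) n = coeff (partial_x p * q + p * partial_x q) n"
    by (simp add: coeff_mult coeff_partial_x sum.distrib)
qed

lemma op_apply_D_op_mult:
  "op_apply D_op (p * q) = op_apply D_op p * q + p * op_apply D_op q"
  by (simp add: partial_x_mult partial_y_def pderiv_mult algebra_simps)

lemma op_apply_D_op_const: "op_apply D_op [:[:c:]:] = 0"
  by (simp add: partial_y_def poly_eq_iff coeff_partial_x coeff_pCons pderiv_pCons split: nat.split)

lemma op_apply_D_op_1: "op_apply D_op 1 = 0"
  using op_apply_D_op_const[of 1] by (simp add: one_pCons)

lemma op_apply_D_op_x: "op_apply D_op var_x = 1"
  by (simp add: partial_y_def var_x_def poly_eq_iff coeff_partial_x coeff_pCons pderiv_pCons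
      split: nat.split)

lemma op_apply_D_op_y: "op_apply D_op var_y = 1"
  by (simp add: partial_y_def var_y_def poly_eq_iff coeff_partial_x coeff_pCons pderiv_pCons
      split: nat.split)

declare op_apply_D_op [simp del]

lemma op_apply_diff: "op_apply f (p - q) = op_apply f p - op_apply f q"
  using op_apply_add[of f "p - q" q] by (simp add: algebra_simps)

lemma op_apply_D_op_delta: "op_apply D_op (var_y - var_x) = 0"
  by (simp add: op_apply_diff op_apply_D_op_x op_apply_D_op_y)

section \<open>The Taylor series exp(t D) p, that is p(x + t, y + t)\<close>

definition taylor :: "rat poly poly \<Rightarrow> rat poly poly fps" where
  "taylor p = Abs_fps (\<lambda>j. smult [:1 / fact j:] (op_apply (D_op ^ j) p))"

lemma taylor_nth_0: "taylor p $ 0 = p"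
  by (simp add: taylor_def one_pCons[symmetric])

lemma fps_deriv_taylor_nth: "fps_deriv (taylor p) $ n = op_apply D_op (taylor p $ n)"
proof -
  have "of_nat (Suc n) * smult [:1 / fact (Suc n):] a = smult [:1 / fact n:] a"
    for a :: "rat poly poly"
    by (simp add: of_nat_poly fact_Suc[of n] del: of_nat_Suc fact_Suc)
  then show ?thesis
    by (simp add: taylor_def del: of_nat_Suc fact_Suc)
qed

text \<open>The equation f' = D f, with D acting on coefficients, determines each coefficient from
  the previous one, because n + 1 can be cancelled in characteristic 0. Identities for
  \<open>taylor\<close> thus reduce to checking this equation and the constant term.\<close>

lemma taylor_unique:
  assumes "f $ 0 = p" and "\<And>n. fps_deriv f $ n = op_apply D_op (f $ n)"
  shows "f = taylor p"
proof (rule fps_ext)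
  fix n
  show "f $ n = taylor p $ n"
  proof (induction n)
    case 0
    then show ?case using assms(1) by (simp add: taylor_nth_0)
  next
    case (Suc n)
    then have "of_nat (Suc n) * f $ Suc n = of_nat (Suc n) * taylor p $ Suc n"
      using assms(2)[of n] fps_deriv_taylor_nth[of p n] by simp
    then show ?case by (simp del: of_nat_Suc)
  qed
qed

text \<open>The formal derivative and the coefficientwise action of D are both derivations, so the
  product solves the same equation.\<close>

lemma taylor_mult: "taylor (p * q) = taylor p * taylor q"
proof (rule taylor_unique[symmetric])
  fix n
  show "fps_deriv (taylor p * taylor q) $ n = op_apply D_op ((taylor p * taylor q) $ n)"
    unfolding fps_deriv_mult fps_add_nth
    by (simp add: fps_mult_nth fps_deriv_taylor_nth op_apply_sum op_apply_D_op_mult sum.distrib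
        del: fps_deriv_nth)
qed (simp add: taylor_nth_0)

lemma taylor_const:
  assumes "op_apply D_op p = 0"
  shows "taylor p = fps_const p"
  by (rule taylor_unique[symmetric]) (simp_all add: assms)

lemma taylor_x: "taylor var_x = fps_const var_x + fps_X"
proof (rule taylor_unique[symmetric])
  fix n
  show "fps_deriv (fps_const var_x + fps_X) $ n =
      op_apply D_op ((fps_const var_x + fps_X :: rat poly poly fps) $ n)"
    by (cases n) (simp_all add: op_apply_D_op_x op_apply_D_op_1 fps_X_def del: One_nat_def)
qed simp

section \<open>Powers of the geometric series x y z / (1 - y z)\<close>

definition taylor_step :: "rat poly poly fps" where
  "taylor_step = Abs_fps (\<lambda>n. if n = 0 then 0 else var_x * var_y ^ n)"

lemma taylor_step_nth_0 [simp]: "taylor_step $ 0 = 0"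
  by (simp add: taylor_step_def)

lemma one_minus_X_nth:
  fixes f :: "'a::comm_ring_1 fps"
  shows "((1 - fps_const a * fps_X) * f) $ n = f $ n - (if n = 0 then 0 else a * f $ (n - 1))"
  by (simp add: left_diff_distrib mult.assoc)

lemma taylor_step_eq:
  "(1 - fps_const var_y * fps_X) * taylor_step = fps_const (var_x * var_y) * fps_X"
proof (rule fps_ext)
  fix n
  show "((1 - fps_const var_y * fps_X) * taylor_step) $ n = (fps_const (var_x * var_y) * fps_X) $ n"
    unfolding one_minus_X_nth
    by (cases n) (simp_all add: taylor_step_def fps_X_def)
qed

lemma one_minus_X_neq_0: "1 - fps_const (a::'a::comm_ring_1) * fps_X \<noteq> 0"
proof
  assume "1 - fps_const a * fps_X = 0"
  then have "(1 - fps_const a * fps_X) $ 0 = 0" by simp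
  then show False by simp
qed

text \<open>This is where the binomial coefficients of \<open>G_op\<close> come from. The claimed
  powers \<open>V k\<close> obey the recursion obtained by multiplying with
  \<open>taylor_step\<close>; it is stated after multiplication by 1 - y z to avoid
  division.\<close>

lemma taylor_step_power_nth:
  "(taylor_step ^ Suc k) $ Suc n = of_nat (n choose k) * var_x ^ Suc k * var_y ^ Suc n"
proof -
  define V where "V k = Abs_fps (\<lambda>n. case n of 0 \<Rightarrow> 0
    | Suc n \<Rightarrow> of_nat (n choose k) * var_x ^ Suc k * var_y ^ Suc n)" for k
  have V_Suc: "(1 - fps_const var_y * fps_X) * V (Suc k) = fps_const (var_x * var_y) * fps_X * V k"
    for k
  proof (rule fps_ext)
    fix n
    show "((1 - fps_const var_y * fps_X) * V (Suc k)) $ n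
        = (fps_const (var_x * var_y) * fps_X * V k) $ n"
      unfolding one_minus_X_nth
      \<comment> \<open>From index 2 on this is Pascal's rule; indices 0 and 1 are the
        boundary.\<close>
      by (cases n; cases "n - 1") (simp_all add: V_def mult.assoc algebra_simps)
  qed
  have "taylor_step ^ Suc k = V k" for k
  proof (induction k)
    case 0
    show ?case
      by (auto simp: fps_eq_iff V_def taylor_step_def split: nat.split)
  next
    case (Suc k)
    have "(1 - fps_const var_y * fps_X) * taylor_step ^ Suc (Suc k)
        = ((1 - fps_const var_y * fps_X) * taylor_step) * taylor_step ^ Suc k"
      by (simp add: mult_ac)
    also have "\<dots> = (1 - fps_const var_y * fps_X) * V (Suc k)"
      by (simp only: taylor_step_eq Suc V_Suc)
    finally show ?case using one_minus_X_neq_0 by (metis mult_left_cancel)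
  qed
  then show ?thesis by (simp add: V_def)
qed

section \<open>The series G(z) p as a ring homomorphism in p\<close>

definition G_ser :: "rat poly poly \<Rightarrow> rat poly poly fps" where
  "G_ser p = Abs_fps (\<lambda>r. op_apply (G_op r) p)"

lemma G_ser_nth [simp]: "G_ser p $ r = op_apply (G_op r) p"
  by (simp add: G_ser_def)

text \<open>The factor D^j p / j! of \<open>G_op r\<close> is a Taylor coefficient, and the
  remaining factor is the coefficient of z^r in the j-th power of the step. So G(z) shifts both x
  and y by x y z / (1 - y z).\<close>

lemma G_ser_eq: "G_ser p = taylor p oo taylor_step"
proof (rule fps_ext)
  fix r
  show "G_ser p $ r = (taylor p oo taylor_step) $ r"
  proof (cases r)
    case 0
    then show ?thesis by (simp add: G_op_def taylor_nth_0)
  next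
    case (Suc n)
    have summand: "var_y ^ r * (smult [:of_nat ((r - 1) choose (j - 1)) / fact j:] (var_x ^ j) * a)
        = smult [:1 / fact j:] a * taylor_step ^ j $ r" if "j \<in> {1..r}" for j a
    proof -
      obtain k where k: "j = Suc k" using \<open>j \<in> {1..r}\<close> by (cases j) auto
      have "smult [:of_nat b / fact j:] c = smult [:1 / fact j:] (of_nat b * c)"
        for b and c :: "rat poly poly"
        by (simp add: of_nat_poly)
      then show ?thesis
        unfolding k Suc taylor_step_power_nth by (simp add: mult_ac)
    qed
    have "(taylor p oo taylor_step) $ r = (\<Sum>j=1..r. taylor p $ j * taylor_step ^ j $ r)"
      \<comment> \<open>The index j = 0 drops out because \<open>taylor_step ^ 0\<close> is 1 and r
        is positive.\<close>
      unfolding fps_compose_nth by (rule sum.mono_neutral_right) (auto simp: Suc not_less_eq_eq)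
    also have "\<dots> = G_ser p $ r"
    proof -
      have "G_ser p $ r = (\<Sum>j=1..r. var_y ^ r *
          (smult [:of_nat ((r - 1) choose (j - 1)) / fact j:] (var_x ^ j) * op_apply (D_op ^ j) p))"
        using Suc unfolding G_ser_nth G_op_def
        by (simp only: nat.simps if_False op_apply_times op_apply_mult_op sum_op_apply sum_distrib_left)
      also have "\<dots> = (\<Sum>j=1..r. taylor p $ j * taylor_step ^ j $ r)"
        by (intro sum.cong refl) (simp only: summand taylor_def fps_nth_Abs_fps)
      finally show ?thesis ..
    qed
    finally show ?thesis by simp
  qed
qed

lemma G_ser_mult: "G_ser (p * q) = G_ser p * G_ser q"
  by (simp add: G_ser_eq taylor_mult fps_compose_mult_distrib)

lemma G_ser_const:
  assumes "op_apply D_op p = 0"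
  shows "G_ser p = fps_const p"
  by (simp add: G_ser_eq taylor_const assms)

lemma G_ser_add: "G_ser (p + q) = G_ser p + G_ser q"
  by (rule fps_ext) simp

lemma G_ser_sum: "G_ser (sum f A) = (\<Sum>i\<in>A. G_ser (f i))"
  by (rule fps_ext) (simp add: fps_sum_nth op_apply_sum)

text \<open>The shifted x is x + x y z / (1 - y z) = x / (1 - y z), recorded with the denominator
  cleared.\<close>

lemma G_ser_x_eq: "(1 - fps_const var_y * fps_X) * G_ser var_x = fps_const var_x"
proof -
  have "G_ser var_x = fps_const var_x + taylor_step"
    by (simp add: G_ser_eq taylor_x fps_compose_add_distrib fps_X_fps_compose_startby0)
  then have "(1 - fps_const var_y * fps_X) * G_ser var_x
      = (1 - fps_const var_y * fps_X) * fps_const var_x + fps_const (var_x * var_y) * fps_X"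
    by (simp only: distrib_left taylor_step_eq)
  then show ?thesis
    by (simp add: algebra_simps flip: fps_const_mult)
qed

lemma G_ser_x_nth: "op_apply (G_op r) var_x = var_x * var_y ^ r"
proof (induction r)
  case (Suc r)
  have "((1 - fps_const var_y * fps_X) * G_ser var_x) $ Suc r = 0"
    by (simp add: G_ser_x_eq)
  then show ?case unfolding one_minus_X_nth using Suc by (simp add: mult_ac)
qed (simp add: G_op_def)

section \<open>The product G(z) G(v) as a ring homomorphism\<close>

definition G_two :: "rat poly poly \<Rightarrow> rat poly poly fps fps" where
  "G_two p = Abs_fps (\<lambda>n. G_ser (op_apply (G_op n) p))"

lemma G_two_mult: "G_two (p * q) = G_two p * G_two q"
proof (rule fps_ext)
  fix n
  \<comment> \<open>Multiplicativity of \<open>G_ser\<close> read off at one coefficient; applying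
    the homomorphism \<open>G_ser\<close> again preserves the convolution.\<close>
  have "op_apply (G_op n) (p * q) =
      (\<Sum>i=0..n. op_apply (G_op i) p * op_apply (G_op (n - i)) q)"
    using arg_cong[OF G_ser_mult, of "\<lambda>f. f $ n" p q] by (simp add: fps_mult_nth)
  then show "G_two (p * q) $ n = (G_two p * G_two q) $ n"
    by (simp add: G_two_def G_ser_sum G_ser_mult fps_mult_nth)
qed

lemma G_two_add: "G_two (p + q) = G_two p + G_two q"
  by (rule fps_ext) (simp add: G_two_def G_ser_add)

lemma G_two_const:
  assumes "op_apply D_op p = 0"
  shows "G_two p = fps_const (fps_const p)"
proof (rule fps_ext)
  fix n
  have "op_apply (G_op n) p = (if n = 0 then p else 0)"
    using arg_cong[OF G_ser_const[OF assms], of "\<lambda>f. f $ n"] by simp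
  moreover have "G_ser 0 = 0" by (rule fps_ext) simp
  ultimately show "G_two p $ n = fps_const (fps_const p) $ n"
    by (simp add: G_two_def G_ser_const assms)
qed

section \<open>Substituting a two-variable series into a one-variable series\<close>

text \<open>Truncating the sum at \<open>n + m\<close> loses nothing only if \<open>w\<close> has zero constant term.\<close>

definition fps_subst2 :: "'a::comm_ring_1 fps fps \<Rightarrow> 'a fps \<Rightarrow> 'a fps fps" where
  "fps_subst2 w f = Abs_fps (\<lambda>n. Abs_fps (\<lambda>m. \<Sum>r\<le>n + m. f $ r * (w ^ r) $ n $ m))"

text \<open>Terms beyond n + m vanish, so different coefficients can share one truncation
  bound.\<close>

lemma fps_subst2_nth:
  assumes "w $ 0 $ 0 = 0" "n + m \<le> N"
  shows "fps_subst2 w f $ n $ m = (\<Sum>r\<le>N. f $ r * (w ^ r) $ n $ m)"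
proof -
  have "(w ^ r) $ n $ m = 0" if "\<not> r \<le> n + m" for r
    using power_low_nth[of w n m r] assms(1) that by simp
  then show ?thesis
    unfolding fps_subst2_def fps_nth_Abs_fps using assms(2)
    by (intro sum.mono_neutral_left) auto
qed

lemma fps_subst2_add: "fps_subst2 w (f + g) = fps_subst2 w f + fps_subst2 w g"
  by (intro fps_ext) (simp add: fps_subst2_def sum.distrib distrib_right)

lemma fps_subst2_const: "fps_subst2 w (fps_const c) = fps_const (fps_const c)"
proof (intro fps_ext)
  fix n m
  have "fps_subst2 w (fps_const c) $ n $ m = (\<Sum>r\<in>{0}. fps_const c $ r * (w ^ r) $ n $ m)"
    unfolding fps_subst2_def fps_nth_Abs_fps by (rule sum.mono_neutral_right) auto
  then show "fps_subst2 w (fps_const c) $ n $ m = fps_const (fps_const c) $ n $ m"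
    by simp
qed

lemma fps_subst2_X:
  assumes "w $ 0 $ 0 = 0"
  shows "fps_subst2 w fps_X = w"
proof (intro fps_ext)
  fix n m
  have "fps_subst2 w fps_X $ n $ m = (\<Sum>r\<le>Suc (n + m). fps_X $ r * (w ^ r) $ n $ m)"
    by (rule fps_subst2_nth[OF assms]) simp
  also have "\<dots> = (\<Sum>r\<in>{1}. fps_X $ r * (w ^ r) $ n $ m)"
    by (rule sum.mono_neutral_right) (auto simp: fps_X_def)
  finally show "fps_subst2 w fps_X $ n $ m = w $ n $ m" by simp
qed

lemma fps_subst2_mult:
  assumes "w $ 0 $ 0 = 0"
  shows "fps_subst2 w (f * g) = fps_subst2 w f * fps_subst2 w g"
proof (intro fps_ext)
  fix n m :: nat
  let ?N = "n + m"
  have supp: "r + s \<le> ?N" if "f $ r * g $ s * (w ^ (r + s)) $ n $ m \<noteq> 0" for r s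
  proof (rule ccontr)
    assume "\<not> r + s \<le> ?N"
    then have "(w ^ (r + s)) $ n $ m = 0"
      by (intro power_low_nth[OF assms]) simp
    with that show False by simp
  qed
  have "(fps_subst2 w f * fps_subst2 w g) $ n $ m =
      (\<Sum>i=0..n. \<Sum>j=0..m. fps_subst2 w f $ i $ j * fps_subst2 w g $ (n - i) $ (m - j))"
    by (simp add: fps_mult_nth fps_sum_nth)
  \<comment> \<open>The bound \<open>?N\<close> is independent of i and j, which allows the sums to
    be interchanged.\<close>
  also have "\<dots> = (\<Sum>i=0..n. \<Sum>j=0..m. \<Sum>r\<le>?N. \<Sum>s\<le>?N.
      f $ r * g $ s * ((w ^ r) $ i $ j * (w ^ s) $ (n - i) $ (m - j)))"
    by (intro sum.cong refl)
      (simp add: fps_subst2_nth[OF assms, where N = "n + m"] sum_product mult_ac)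
  also have "\<dots> = (\<Sum>i=0..n. \<Sum>r\<le>?N. \<Sum>j=0..m. \<Sum>s\<le>?N.
      f $ r * g $ s * ((w ^ r) $ i $ j * (w ^ s) $ (n - i) $ (m - j)))"
    by (intro sum.cong refl sum.swap)
  also have "\<dots> = (\<Sum>r\<le>?N. \<Sum>i=0..n. \<Sum>j=0..m. \<Sum>s\<le>?N.
      f $ r * g $ s * ((w ^ r) $ i $ j * (w ^ s) $ (n - i) $ (m - j)))"
    by (rule sum.swap)
  also have "\<dots> = (\<Sum>r\<le>?N. \<Sum>i=0..n. \<Sum>s\<le>?N. \<Sum>j=0..m.
      f $ r * g $ s * ((w ^ r) $ i $ j * (w ^ s) $ (n - i) $ (m - j)))"
    by (intro sum.cong refl sum.swap)
  also have "\<dots> = (\<Sum>r\<le>?N. \<Sum>s\<le>?N. \<Sum>i=0..n. \<Sum>j=0..m.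
      f $ r * g $ s * ((w ^ r) $ i $ j * (w ^ s) $ (n - i) $ (m - j)))"
    by (intro sum.cong refl sum.swap)
  also have "\<dots> = (\<Sum>r\<le>?N. \<Sum>s\<le>?N. f $ r * g $ s * (w ^ (r + s)) $ n $ m)"
    by (simp add: power_add fps_mult_nth fps_sum_nth sum_distrib_left)
  also have "\<dots> = (\<Sum>(r, s)\<in>{..?N} \<times> {..?N}. f $ r * g $ s * (w ^ (r + s)) $ n $ m)"
    by (simp add: sum.cartesian_product)
  \<comment> \<open>\<open>supp\<close> cuts the square down to a triangle, which is then regrouped
    by k = r + s.\<close>
  also have "\<dots> = (\<Sum>(r, s)\<in>{(r, s). r + s \<le> ?N}. f $ r * g $ s * (w ^ (r + s)) $ n $ m)"
    by (rule sum.mono_neutral_right) (auto intro: supp)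
  also have "\<dots> = (\<Sum>k\<le>?N. \<Sum>r\<le>k. f $ r * g $ (k - r) * (w ^ (r + (k - r))) $ n $ m)"
    by (rule sum.triangle_reindex_eq)
  also have "\<dots> = fps_subst2 w (f * g) $ n $ m"
    unfolding fps_subst2_def fps_nth_Abs_fps
    by (intro sum.cong refl) (simp add: fps_mult_nth sum_distrib_right atLeast0AtMost)
  finally show "fps_subst2 w (f * g) $ n $ m = (fps_subst2 w f * fps_subst2 w g) $ n $ m" ..
qed

section \<open>From operator coefficients to polynomial coefficients\<close>

definition arg_ser :: "rat poly poly fps fps" where
  "arg_ser = fps_const fps_X + fps_X
     - fps_const (fps_const (var_y - var_x)) * fps_const fps_X * fps_X"

lemma arg_ser_nth_0: "arg_ser $ 0 $ 0 = 0"
  by (simp add: arg_ser_def)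

lemma op_apply_D_op_arg_ser_power: "op_apply D_op ((arg_ser ^ r) $ n $ m) = 0"
proof (induction r arbitrary: n m)
  case 0
  show ?case by (simp add: op_apply_D_op_1)
next
  case (Suc r)
  have "op_apply D_op (arg_ser $ n $ m) = 0" for n m
    by (auto simp: arg_ser_def fps_X_def op_apply_diff op_apply_D_op_1 op_apply_D_op_x
        op_apply_D_op_y op_apply_D_op_mult)
  with Suc show ?case
    by (simp add: fps_mult_nth fps_sum_nth op_apply_sum op_apply_D_op_mult)
qed

lemma mult_op_mult: "mult_op (a * b) = mult_op a * mult_op b"
  by (rule polyop_eqI) (simp add: mult_ac)

lemma mult_op_sum: "mult_op (sum f A) = (\<Sum>i\<in>A. mult_op (f i))"
  by (rule polyop_eqI) (simp add: sum_op_apply sum_distrib_right)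

lemma mult_op_power_nth:
  assumes "\<And>n m. w $ n $ m = mult_op (u $ n $ m)"
  shows "(w ^ r) $ n $ m = mult_op ((u ^ r) $ n $ m)"
proof (induction r arbitrary: n m)
  case 0
  show ?case by (rule polyop_eqI) simp
next
  case (Suc r)
  then show ?case
    by (simp add: fps_mult_nth fps_sum_nth mult_op_sum mult_op_mult assms)
qed

text \<open>All coefficients of the argument are multiplication operators, so its powers can be
  computed over the commutative ring Q[x,y].\<close>

lemma arg_ser_op_nth:
  "(ser_z + ser_v - ser_op delta_op * ser_z * ser_v) $ n $ m = mult_op (arg_ser $ n $ m)"
  by (rule polyop_eqI) (auto simp: ser_z_def ser_v_def ser_op_def arg_ser_def delta_op_def
      fps_X_def algebra_simps)

text \<open>Since G(z) is multiplicative and fixes the kernel of D, each \<open>G_op r\<close> is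
  linear over that kernel. This moves the coefficients of powers of \<open>arg_ser\<close> out of
  the operators.\<close>

lemma op_apply_G_op_mult:
  assumes "op_apply D_op a = 0"
  shows "op_apply (G_op r) (a * p) = a * op_apply (G_op r) p"
  using arg_cong[OF G_ser_mult, of "\<lambda>f. f $ r" a p] by (simp add: G_ser_const assms)

lemma ser_op_nth: "(ser_op A * w) $ n $ m = A * w $ n $ m"
  by (simp add: ser_op_def)

lemma op_apply_G_at_arg:
  "op_apply (G_at (ser_z + ser_v - ser_op delta_op * ser_z * ser_v) $ n $ m) p
    = fps_subst2 arg_ser (G_ser p) $ n $ m" (is "op_apply (G_at ?w $ n $ m) p = _")
proof -
  have "?w $ 0 $ 0 = 0"
    by (simp add: ser_z_def ser_v_def ser_op_def)
  \<comment> \<open>The formal sum over all r becomes the same truncation as in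
    \<open>fps_subst2\<close>.\<close>
  from G_at_support[OF this, of n m]
  have "G_at ?w $ n $ m = (\<Sum>r\<le>n + m. (ser_op (G_op r) * ?w ^ r) $ n $ m)"
    unfolding G_at_def fps_nth_Abs_fps by (intro Sum_any.expand_superset) auto
  also have "\<dots> = (\<Sum>r\<le>n + m. G_op r * mult_op ((arg_ser ^ r) $ n $ m))"
    by (simp only: ser_op_nth mult_op_power_nth[OF arg_ser_op_nth])
  finally show ?thesis
    by (simp add: sum_op_apply fps_subst2_def op_apply_G_op_mult op_apply_D_op_arg_ser_power)
      (simp add: mult.commute)
qed

text \<open>The right factor acts first. One factor is constant in v and the other has coefficients
  constant in z, so no convolution remains.\<close>

lemma op_apply_G_at_mult: "op_apply ((G_at ser_z * G_at ser_v) $ n $ m) p = G_two p $ n $ m"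
  by (simp add: G_at_z G_at_v G_two_def)

section \<open>Comparison of both sides on x, and the conclusion\<close>

lemma fps_subst2_G_ser_x:
  "(1 - fps_const (fps_const var_y) * arg_ser) * fps_subst2 arg_ser (G_ser var_x)
    = fps_const (fps_const var_x)"
proof -
  have "fps_subst2 arg_ser (1 - fps_const var_y * fps_X) + fps_const (fps_const var_y) * arg_ser
     = fps_subst2 arg_ser ((1 - fps_const var_y * fps_X) + fps_const var_y * fps_X)"
    unfolding fps_subst2_add
    by (simp add: fps_subst2_mult arg_ser_nth_0 fps_subst2_const fps_subst2_X)
  also have "\<dots> = 1"
    using fps_subst2_const[of arg_ser 1] by simp
  finally have "fps_subst2 arg_ser (1 - fps_const var_y * fps_X)
      = 1 - fps_const (fps_const var_y) * arg_ser"
    by (simp add: algebra_simps)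
  then show ?thesis
    by (metis G_ser_x_eq arg_ser_nth_0 fps_subst2_const fps_subst2_mult)
qed

text \<open>Put g = x / (1 - y z). Applying G(z) to G(v) x = x / (1 - y v) replaces x by g and y by
  g + delta, which gives g / (1 - (g + delta) v).\<close>

lemma G_two_x:
  "(1 - fps_const (fps_const var_y) * arg_ser) * G_two var_x = fps_const (fps_const var_x)"
proof -
  let ?c = "\<lambda>a. fps_const (fps_const a) :: rat poly poly fps fps"
  let ?z = "fps_const fps_X :: rat poly poly fps fps"
  let ?gx = "fps_const (G_ser var_x)"
  have y: "var_y = var_x + (var_y - var_x)" by simp
  have gy: "G_ser var_y = G_ser var_x + fps_const (var_y - var_x)"
    by (subst y, subst G_ser_add) (simp only: G_ser_const[OF op_apply_D_op_delta])
  \<comment> \<open>Here t stands for \<open>G_two var_x\<close>. By (1 - y z) g = x the last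
    summand vanishes, and the first reduces to (1 - y z) g = x.\<close>
  have eq: "(1 - y * (z + v - (y - x) * z * v)) * t =
      (1 - y * z) * ((1 - (g + (y - x)) * v) * t) + ((1 - y * z) * g - x) * v * t"
    for x y z v g t :: "rat poly poly fps fps"
    by (simp add: algebra_simps)
  have v: "(1 - fps_const (G_ser var_y) * fps_X) * G_two var_x = ?gx"
  proof (rule fps_ext)
    fix n
    show "((1 - fps_const (G_ser var_y) * fps_X) * G_two var_x) $ n = ?gx $ n"
      unfolding one_minus_X_nth
      by (cases n) (simp_all add: G_two_def G_ser_x_nth G_ser_mult G_ser_const op_apply_D_op_1 mult_ac)
  qed
  have z: "(1 - ?c var_y * ?z) * ?gx = ?c var_x"
  proof -
    have "(1 - ?c var_y * ?z) * ?gx = fps_const ((1 - fps_const var_y * fps_X) * G_ser var_x)"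
      by (simp add: left_diff_distrib)
    then show ?thesis by (simp only: G_ser_x_eq)
  qed
  have g: "fps_const (G_ser var_y) = ?gx + (?c var_y - ?c var_x)"
    by (simp add: gy)
  have arg: "arg_ser = ?z + fps_X - (?c var_y - ?c var_x) * ?z * fps_X"
    by (simp add: arg_ser_def)
  have "(1 - ?c var_y * arg_ser) * G_two var_x =
      (1 - ?c var_y * ?z) * ((1 - (?gx + (?c var_y - ?c var_x)) * fps_X) * G_two var_x)
      + ((1 - ?c var_y * ?z) * ?gx - ?c var_x) * fps_X * G_two var_x"
    unfolding arg by (rule eq)
  also have "\<dots> = ?c var_x"
    by (simp only: v[unfolded g] z) simp
  finally show ?thesis .
qed

lemma G_two_eq: "G_two p = fps_subst2 arg_ser (G_ser p)"
proof -
  let ?P = "\<lambda>p. G_two p = fps_subst2 arg_ser (G_ser p)"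
  have add: "?P (p + q)" if "?P p" "?P q" for p q
    using that by (simp add: G_two_add G_ser_add fps_subst2_add)
  have mult: "?P (p * q)" if "?P p" "?P q" for p q
    using that by (simp add: G_two_mult G_ser_mult fps_subst2_mult arg_ser_nth_0)
  have const: "?P p" if "op_apply D_op p = 0" for p
    using that by (simp add: G_two_const G_ser_const fps_subst2_const)
  have "(1 - fps_const (fps_const var_y) * arg_ser) $ 0 $ 0 = 1"
    by (simp add: arg_ser_nth_0)
  \<comment> \<open>Power series over an integral domain form an integral domain, so this common
    factor can be cancelled.\<close>
  then have "1 - fps_const (fps_const var_y) * arg_ser \<noteq> 0"
    by (metis fps_zero_nth zero_neq_one)
  then have x: "?P var_x"
    using G_two_x fps_subst2_G_ser_x by (metis mult_left_cancel)
  have y: "?P var_y"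
    using add[OF x const[OF op_apply_D_op_delta]] by simp
  \<comment> \<open>Horner's scheme, first in x for the coefficients and then in y, reaches every
    polynomial.\<close>
  have coeff: "?P [:a:]" for a
  proof (induction a)
    case 0
    show ?case using const[of 0] by simp
  next
    case (pCons c a)
    have "[:pCons c a:] = [:[:c:]:] + var_x * [:a:]" by (simp add: var_x_def)
    then show ?case
      using add[OF const[OF op_apply_D_op_const] mult[OF x pCons.IH]] by simp
  qed
  show ?thesis
  proof (induction p)
    case 0
    show ?case using const[of 0] by simp
  next
    case (pCons a p)
    have "pCons a p = [:a:] + var_y * p" by (simp add: var_y_def)
    then show ?case using add[OF coeff mult[OF y pCons.IH]] by simp
  qed
qed

theorem theorem7:
  shows "G_at ser_z * G_at ser_v = G_at (ser_z + ser_v - ser_op delta_op * ser_z * ser_v)"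
  by (intro fps_ext polyop_eqI)
    (simp only: op_apply_G_at_mult op_apply_G_at_arg G_two_eq)

end
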